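(* Let $M\in\mathbb N$ and $\mathcal A\subset\{0,\dots,M-1\}$ with $1<|\mathcal A|<M$, and let $\delta=\log|\mathcal A|/\log M$. Define the 1-periodic function $$G_{\mathcal A}(x)=\frac1{\sqrt M}\sum_{a\in\mathcal A}\exp(-2\pi iax),\quad x\in\mathbb R.$$ Assume that $$G_{\mathcal A}\Big(\frac{b-b'}M\Big)=0\quad\text{for all }b,b'\in\mathcal A,\ b\ne b'.$$ Then $$r_k=\Big(\frac{|\mathcal A|}M\Big)^{k/2}\quad\text{for all }k\in\mathbb N,$$ and thus the fractal uncertainty exponent is $\beta(M,\mathcal A)=(1-\delta)/2$.
   Context: $\mathbb Z_N=\mathbb Z/N\mathbb Z\simeq\{0,\dots,N-1\}$; $\ell^2_N$ is the space of functions $u:\mathbb Z_N\to\mathbb C$ with $\|u\|_{\ell^2_N}^2=\sum_j|u(j)|^2$; $\mathcal F_Nu(j)=\frac1{\sqrt N}\sum_{\ell=0}^{N-1}\exp(-2\pi ij\ell/N)u(\ell)$; $\mathbf 1_X$ is multiplication by the indicator function of $X\subset\mathbb Z_N$. For $N=M^k$: $\mathcal C_k=\{\sum_{j=0}^{k-1}a_jM^j\mid a_0,\dots,a_{k-1}\in\mathcal A\}\subset\mathbb Z_N$ and $r_k=\|\mathbf 1_{\mathcal C_k}\mathcal F_N\mathbf 1_{\mathcal C_k}\|_{\ell^2_N\to\ell^2_N}$. The fractal uncertainty exponent is $\beta(M,\mathcal A)=-\lim_{k\to\infty}\frac{\log r_k}{k\log M}$ (the limit exists). *)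

theory Defs
  imports "HOL-Analysis.Analysis"
begin

text \<open>
  The dimension \<open>N = M ^ k\<close> varies, so \<open>\<int>/N\<int>\<close> is represented by \<open>{..<N}\<close> and functions on it
  by the extensional functions on \<open>{..<N}\<close> (value \<^const>\<open>undefined\<close> outside).
\<close>

definition ell2 :: "nat \<Rightarrow> (nat \<Rightarrow> complex) set" where
  "ell2 N = {..<N} \<rightarrow>\<^sub>E UNIV"

definition ell2_norm :: "nat \<Rightarrow> (nat \<Rightarrow> complex) \<Rightarrow> real" where
  "ell2_norm N u = L2_set (\<lambda>j. cmod (u j)) {..<N}"

text \<open>As in \<^const>\<open>onorm\<close>, the zero vector contributes \<open>0 / 0 = 0\<close>, so the supremum is harmless there.\<close>

definition ell2_opnorm :: "nat \<Rightarrow> ((nat \<Rightarrow> complex) \<Rightarrow> nat \<Rightarrow> complex) \<Rightarrow> real" where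
  "ell2_opnorm N T = (SUP u\<in>ell2 N. ell2_norm N (T u) / ell2_norm N u)"

definition dft :: "nat \<Rightarrow> (nat \<Rightarrow> complex) \<Rightarrow> nat \<Rightarrow> complex" where
  "dft N u = (\<lambda>j\<in>{..<N}. complex_of_real (1 / sqrt (real N)) *
     (\<Sum>l<N. exp (- 2 * complex_of_real pi * \<i> * of_nat j * of_nat l / of_nat N) * u l))"

definition ind_mult :: "nat \<Rightarrow> nat set \<Rightarrow> (nat \<Rightarrow> complex) \<Rightarrow> nat \<Rightarrow> complex" where
  "ind_mult N X u = (\<lambda>j\<in>{..<N}. indicator X j * u j)"

text \<open>For \<open>A \<subseteq> {..<M}\<close> the sums below are \<open>< M ^ k\<close>, so no reduction modulo \<open>M ^ k\<close> is needed.\<close>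

definition cantor_set :: "nat \<Rightarrow> nat set \<Rightarrow> nat \<Rightarrow> nat set" where
  "cantor_set M A k = {\<Sum>j<k. a j * M ^ j |a. \<forall>j<k. a j \<in> A}"

definition cantor_norm :: "nat \<Rightarrow> nat set \<Rightarrow> nat \<Rightarrow> real" where
  "cantor_norm M A k = ell2_opnorm (M ^ k)
     (ind_mult (M ^ k) (cantor_set M A k) \<circ> dft (M ^ k) \<circ> ind_mult (M ^ k) (cantor_set M A k))"

definition fup_quotient :: "nat \<Rightarrow> nat set \<Rightarrow> nat \<Rightarrow> real" where
  "fup_quotient M A k = ln (cantor_norm M A k) / (real k * ln (real M))"

text \<open>Meaningful only when \<open>fup_quotient M A\<close> converges, since \<^const>\<open>lim\<close> is a definite description.\<close>

definition fup_exponent :: "nat \<Rightarrow> nat set \<Rightarrow> real" where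
  "fup_exponent M A = - lim (fup_quotient M A)"

definition G_fun :: "nat \<Rightarrow> nat set \<Rightarrow> real \<Rightarrow> complex" where
  "G_fun M A x = complex_of_real (1 / sqrt (real M)) *
     (\<Sum>a\<in>A. exp (- 2 * complex_of_real pi * \<i> * of_nat a * complex_of_real x))"

lemma G_fun_periodic: "G_fun M A (x + 1) = G_fun M A x"
proof -
  have "exp (- 2 * complex_of_real pi * \<i> * of_nat a * complex_of_real (x + 1)) =
        exp (- 2 * complex_of_real pi * \<i> * of_nat a * complex_of_real x)" for a :: nat
    unfolding exp_eq by (rule exI[of _ "- int a"]) (simp add: algebra_simps)
  then show ?thesis
    by (simp add: G_fun_def)
qed

end

theory Submission
  imports Defs
begin

text \<open>
  Write \<open>N = M\<^sup>k\<close>, \<open>C = C\<^sub>k\<close>. The claim is that the columns of the \<open>C \<times> C\<close> block of the Fourier matrix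
  are orthogonal, each of squared norm \<open>|C| / N = (|A| / M)\<^sup>k\<close>. The block is then
  \<open>(|A| / M)\<^bsup>k/2\<^esup>\<close> times a unitary matrix, so its norm is that number.

  The inner product of the columns \<open>l\<close> and \<open>l'\<close> is \<open>(1 / N) \<Sum>j\<in>C. exp (-2\<pi>ij(l - l')/N)\<close>.
  The digits of \<open>j\<close> vary independently over \<open>A\<close>, so the sum is, up to a power of \<open>\<surd>M\<close>, the product of the
  values \<open>G (M\<^sup>i (l - l') / N)\<close> over \<open>i < k\<close> (\<open>cantor_exp_sum\<close>). If \<open>l\<close> and \<open>l'\<close> differ and \<open>m\<close> is
  the lowest position at which their digits \<open>b \<noteq> b'\<close> differ, the factor \<open>i = k - 1 - m\<close> has, modulo 1,
  the argument \<open>(b - b') / M\<close>, because higher digits contribute integers. By hypothesis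
  this factor vanishes (\<open>G_fun_zero_of_distinct\<close>).
\<close>

section \<open>Cantor sets by digits\<close>

lemma cantor_set_0: "cantor_set M A 0 = {0}"
  by (auto simp: cantor_set_def)

lemma cantor_set_Suc:
  "cantor_set M A (Suc k) = (\<lambda>(a, c). c + a * M ^ k) ` (A \<times> cantor_set M A k)"
proof (intro equalityI subsetI)
  fix x assume "x \<in> cantor_set M A (Suc k)"
  then obtain d where d: "\<forall>j<Suc k. d j \<in> A" and x: "x = (\<Sum>j<Suc k. d j * M ^ j)"
    by (auto simp: cantor_set_def)
  have "(\<Sum>j<k. d j * M ^ j) \<in> cantor_set M A k"
    using d unfolding cantor_set_def by auto
  then show "x \<in> (\<lambda>(a, c). c + a * M ^ k) ` (A \<times> cantor_set M A k)"
    using d x by (intro image_eqI[of _ _ "(d k, \<Sum>j<k. d j * M ^ j)"]) auto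
next
  fix x assume "x \<in> (\<lambda>(a, c). c + a * M ^ k) ` (A \<times> cantor_set M A k)"
  then obtain a d where a: "a \<in> A" and d: "\<forall>j<k. d j \<in> A"
    and x: "x = (\<Sum>j<k. d j * M ^ j) + a * M ^ k"
    by (auto simp: cantor_set_def)
  have "x = (\<Sum>j<Suc k. (d(k := a)) j * M ^ j)"
    by (simp add: x)
  moreover have "\<forall>j<Suc k. (d(k := a)) j \<in> A"
    using a d by (auto simp: less_Suc_eq)
  ultimately show "x \<in> cantor_set M A (Suc k)"
    unfolding cantor_set_def by blast
qed

lemma cantor_set_bounded:
  assumes "A \<subseteq> {0..<M}"
  shows "cantor_set M A k \<subseteq> {..<M ^ k}"
proof (induction k)
  case 0
  then show ?case by (simp add: cantor_set_0)
next
  case (Suc k)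
  have "c + a * M ^ k < M ^ Suc k" if "a \<in> A" "c \<in> cantor_set M A k" for a c
  proof -
    have "c < M ^ k" and "a < M"
      using that Suc assms by auto
    then have "c + a * M ^ k < Suc a * M ^ k" by simp
    also have "\<dots> \<le> M * M ^ k"
      using \<open>a < M\<close> by (intro mult_right_mono) auto
    finally show ?thesis by simp
  qed
  then show ?case
    by (auto simp: cantor_set_Suc)
qed

lemma finite_cantor_set:
  assumes "A \<subseteq> {0..<M}"
  shows "finite (cantor_set M A k)"
  using cantor_set_bounded[OF assms] finite_subset by blast

lemma cantor_set_nonempty:
  assumes "A \<noteq> {}"
  shows "cantor_set M A k \<noteq> {}"
  using assms by (induction k) (auto simp: cantor_set_0 cantor_set_Suc)

lemma inj_on_cantor_digit:
  assumes "A \<subseteq> {0..<M}"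
  shows "inj_on (\<lambda>(a, c). c + a * M ^ k) (A \<times> cantor_set M A k)"
proof (rule inj_onI, clarify)
  fix a c a' c'
  assume "c \<in> cantor_set M A k" "c' \<in> cantor_set M A k"
    and eq: "c + a * M ^ k = c' + a' * M ^ k"
  then have lt: "c < M ^ k" "c' < M ^ k"
    using cantor_set_bounded[OF assms] by auto
  have "c = c'"
    using arg_cong[OF eq, of "\<lambda>x. x mod M ^ k"] lt by simp
  moreover have "a = a'"
    using eq \<open>c = c'\<close> lt by (auto simp: zero_power)
  ultimately show "a = a' \<and> c = c'" by simp
qed

lemma sum_cantor_set_Suc:
  fixes f :: "nat \<Rightarrow> 'b::comm_monoid_add"
  assumes "A \<subseteq> {0..<M}"
  shows "(\<Sum>x\<in>cantor_set M A (Suc k). f x) = (\<Sum>a\<in>A. \<Sum>c\<in>cantor_set M A k. f (c + a * M ^ k))"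
  unfolding cantor_set_Suc sum.reindex[OF inj_on_cantor_digit[OF assms]] sum.cartesian_product
  by (simp add: case_prod_unfold)

lemma card_cantor_set:
  assumes "A \<subseteq> {0..<M}"
  shows "card (cantor_set M A k) = card A ^ k"
  by (induction k)
    (simp_all add: cantor_set_0 cantor_set_Suc card_image[OF inj_on_cantor_digit[OF assms]]
      card_cartesian_product)

section \<open>Exponential sums over Cantor sets\<close>

text \<open>The exponential turns the digit expansion of \<open>j\<close> into a product of functions of single
  digits, so the sum over all digit strings factorizes.\<close>

lemma cantor_exp_sum:
  assumes "A \<subseteq> {0..<M}" "0 < M"
  shows "(\<Sum>j\<in>cantor_set M A k. exp (- 2 * complex_of_real pi * \<i> * of_nat j * complex_of_real x)) =
         (\<Prod>i<k. complex_of_real (sqrt (real M)) * G_fun M A (real (M ^ i) * x))"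
proof (induction k)
  case 0
  then show ?case by (simp add: cantor_set_0)
next
  case (Suc k)
  let ?e = "\<lambda>j y. exp (- 2 * complex_of_real pi * \<i> * of_nat j * complex_of_real y)"
  have split: "?e (c + a * M ^ k) x = ?e c x * ?e a (real (M ^ k) * x)" for a c
    by (simp add: exp_add[symmetric] algebra_simps)
  have "(\<Sum>j\<in>cantor_set M A (Suc k). ?e j x) =
        (\<Sum>c\<in>cantor_set M A k. ?e c x) * (\<Sum>a\<in>A. ?e a (real (M ^ k) * x))"
    unfolding sum_cantor_set_Suc[OF assms(1)] split sum_product
    by (rule sum.swap)
  also have "(\<Sum>a\<in>A. ?e a (real (M ^ k) * x)) =
      complex_of_real (sqrt (real M)) * G_fun M A (real (M ^ k) * x)"
    using assms(2) by (simp add: G_fun_def)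
  finally show ?case
    unfolding Suc.IH prod.lessThan_Suc .
qed

lemma G_fun_add_int: "G_fun M A (x + of_int n) = G_fun M A x"
proof -
  have "exp (- 2 * complex_of_real pi * \<i> * of_nat a * complex_of_real (x + of_int n)) =
        exp (- 2 * complex_of_real pi * \<i> * of_nat a * complex_of_real x)" for a :: nat
    unfolding exp_eq by (rule exI[of _ "- int a * n"]) (simp add: algebra_simps)
  then show ?thesis
    by (simp add: G_fun_def)
qed

text \<open>Induction on the top digit: if the remaining digits already differ, the top digit adds
  an integer to the argument of the next factor, which periodicity removes; if they agree, the factor
  \<open>i = 0\<close> sees exactly the difference of the top digits over \<open>M\<close>.\<close>

lemma G_fun_zero_of_distinct:
  assumes "0 < M"
    and zero: "\<forall>b\<in>A. \<forall>b'\<in>A. b \<noteq> b' \<longrightarrow> G_fun M A ((real b - real b') / real M) = 0"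
    and "l \<in> cantor_set M A k" "l' \<in> cantor_set M A k" "l \<noteq> l'"
  shows "\<exists>i<k. G_fun M A (real (M ^ i) * ((real l - real l') / real (M ^ k))) = 0"
  using assms(3-5)
proof (induction k arbitrary: l l')
  case 0
  then show ?case by (simp add: cantor_set_0)
next
  case (Suc k)
  from Suc.prems(1,2) obtain a c a' c' where
    mem: "a \<in> A" "a' \<in> A" "c \<in> cantor_set M A k" "c' \<in> cantor_set M A k" and
    l: "l = c + a * M ^ k" and l': "l' = c' + a' * M ^ k"
    by (auto simp: cantor_set_Suc)
  show ?case
  proof (cases "c = c'")
    case True
    then have "a \<noteq> a'"
      using Suc.prems(3) l l' by auto
    moreover have "real (M ^ 0) * ((real l - real l') / real (M ^ Suc k)) = (real a - real a') / real M"
      using \<open>0 < M\<close> True by (simp add: l l' field_simps)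
    ultimately show ?thesis
      using zero mem by (intro exI[of _ 0]) simp
  next
    case False
    then obtain i where "i < k"
      and i: "G_fun M A (real (M ^ i) * ((real c - real c') / real (M ^ k))) = 0"
      using Suc.IH mem by blast
    have "real (M ^ Suc i) * ((real l - real l') / real (M ^ Suc k)) =
        real (M ^ i) * ((real c - real c') / real (M ^ k)) + of_int (int (M ^ i) * (int a - int a'))"
      using \<open>0 < M\<close> by (simp add: l l' field_simps)
    then show ?thesis
      using i \<open>i < k\<close> by (intro exI[of _ "Suc i"]) (simp only: G_fun_add_int Suc_less_eq simp_thms)
  qed
qed

lemma cantor_exp_sum_orthogonal:
  assumes "A \<subseteq> {0..<M}" "0 < M"
    and "\<forall>b\<in>A. \<forall>b'\<in>A. b \<noteq> b' \<longrightarrow> G_fun M A ((real b - real b') / real M) = 0"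
    and "l \<in> cantor_set M A k" "l' \<in> cantor_set M A k"
  shows "(\<Sum>j\<in>cantor_set M A k. exp (- 2 * complex_of_real pi * \<i> * of_nat j *
           complex_of_real ((real l - real l') / real (M ^ k)))) =
         (if l = l' then of_nat (card A ^ k) else 0)"
proof (cases "l = l'")
  case True
  then show ?thesis
    using card_cantor_set[OF assms(1)] by simp
next
  case False
  then obtain i where "i < k" "G_fun M A (real (M ^ i) * ((real l - real l') / real (M ^ k))) = 0"
    using G_fun_zero_of_distinct[OF assms(2-5)] by blast
  then show ?thesis
    unfolding cantor_exp_sum[OF assms(1,2)] using False by auto
qed

section \<open>The norm of a Fourier block with orthogonal columns\<close>

text \<open>Orthogonality of the columns says \<open>K\<^sup>*K = c I\<close>, and \<open>\<parallel>K w\<parallel>\<^sup>2 = \<langle>K\<^sup>*K w, w\<rangle>\<close>.\<close>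

lemma sum_norm_sq_of_orthogonal_columns:
  fixes K :: "'i \<Rightarrow> 'j \<Rightarrow> complex" and c :: real
  assumes orth: "\<And>l l'. l \<in> Y \<Longrightarrow> l' \<in> Y \<Longrightarrow>
      (\<Sum>j\<in>X. K j l * cnj (K j l')) = (if l = l' then of_real c else 0)"
    and "finite Y"
  shows "(\<Sum>j\<in>X. (cmod (\<Sum>l\<in>Y. K j l * w l))\<^sup>2) = c * (\<Sum>l\<in>Y. (cmod (w l))\<^sup>2)"
proof -
  have "complex_of_real (\<Sum>j\<in>X. (cmod (\<Sum>l\<in>Y. K j l * w l))\<^sup>2) =
      (\<Sum>j\<in>X. \<Sum>l\<in>Y. \<Sum>l'\<in>Y. (w l * cnj (w l')) * (K j l * cnj (K j l')))"
    by (simp add: complex_norm_square sum_product cnj_sum mult_ac del: of_real_power)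
  also have "\<dots> = (\<Sum>l\<in>Y. \<Sum>j\<in>X. \<Sum>l'\<in>Y. (w l * cnj (w l')) * (K j l * cnj (K j l')))"
    by (rule sum.swap)
  also have "\<dots> = (\<Sum>l\<in>Y. \<Sum>l'\<in>Y. \<Sum>j\<in>X. (w l * cnj (w l')) * (K j l * cnj (K j l')))"
    by (intro sum.cong refl sum.swap)
  also have "\<dots> = (\<Sum>l\<in>Y. \<Sum>l'\<in>Y. if l = l' then (w l * cnj (w l')) * of_real c else 0)"
    by (intro sum.cong refl) (simp add: sum_distrib_left[symmetric] orth)
  also have "\<dots> = complex_of_real (c * (\<Sum>l\<in>Y. (cmod (w l))\<^sup>2))"
    using \<open>finite Y\<close>
    by (simp add: complex_norm_square sum_distrib_left mult_ac del: of_real_power)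
  finally show ?thesis
    by (simp only: of_real_eq_iff)
qed

text \<open>The truncation \<open>u \<mapsto> \<one>\<^sub>X u\<close> can only decrease the norm and fixes vectors supported on \<open>X\<close>, so the
  ratio in the operator norm is at most \<open>\<surd>c\<close>, with equality for every nonzero vector supported on \<open>X\<close>;
  the indicator function of \<open>X\<close> serves as such a vector.\<close>

lemma ell2_opnorm_of_orthogonal_block:
  fixes N :: nat and X :: "nat set" and c :: real
  assumes X: "X \<subseteq> {..<N}" "X \<noteq> {}" and "0 \<le> c"
    and orth: "\<And>l l'. l \<in> X \<Longrightarrow> l' \<in> X \<Longrightarrow>
      (\<Sum>j\<in>X. exp (- 2 * complex_of_real pi * \<i> * of_nat j *
        complex_of_real ((real l - real l') / real N))) = (if l = l' then of_real (real N * c) else 0)"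
  shows "ell2_opnorm N (ind_mult N X \<circ> dft N \<circ> ind_mult N X) = sqrt c"
proof -
  let ?T = "ind_mult N X \<circ> dft N \<circ> ind_mult N X"
  define K where "K j l = complex_of_real (1 / sqrt (real N)) *
     exp (- 2 * complex_of_real pi * \<i> * of_nat j * of_nat l / of_nat N)" for j l
  have "N > 0" using X by auto
  have fin: "finite X" using X(1) finite_subset by blast
  have XN: "{..<N} \<inter> X = X" using X(1) by auto
  have KK: "K j l * cnj (K j l') = complex_of_real (1 / real N) *
      exp (- 2 * complex_of_real pi * \<i> * of_nat j * complex_of_real ((real l - real l') / real N))" for j l l'
  proof -
    let ?s = "complex_of_real (1 / sqrt (real N))"
    let ?e = "\<lambda>l. exp (- 2 * complex_of_real pi * \<i> * of_nat j * of_nat l / of_nat N)"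
    have s: "?s * ?s = complex_of_real (1 / real N)"
      unfolding of_real_mult[symmetric] by simp
    have e: "?e l * cnj (?e l') =
        exp (- 2 * complex_of_real pi * \<i> * of_nat j * complex_of_real ((real l - real l') / real N))"
      unfolding exp_cnj exp_add[symmetric]
      by (rule arg_cong[of _ _ exp]) (simp add: right_diff_distrib diff_divide_distrib)
    have "K j l * cnj (K j l') = (?s * ?s) * (?e l * cnj (?e l'))"
      unfolding K_def complex_cnj_mult complex_cnj_complex_of_real by (simp only: mult_ac)
    then show ?thesis
      by (simp only: s e)
  qed
  have orthK: "(\<Sum>j\<in>X. K j l * cnj (K j l')) = (if l = l' then of_real c else 0)"
    if "l \<in> X" "l' \<in> X" for l l'
    unfolding KK sum_distrib_left[symmetric] orth[OF that] using \<open>N > 0\<close> by simp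
  have T: "?T u j = indicator X j * (\<Sum>l\<in>X. K j l * u l)" if "j < N" for u j
  proof -
    have "(\<Sum>l<N. K j l * (indicator X l * u l)) = (\<Sum>l\<in>X. K j l * u l)"
      using XN by (intro sum.mono_neutral_cong_right) (auto simp: indicator_def)
    then show ?thesis
      using that by (simp add: ind_mult_def dft_def K_def sum_distrib_left mult_ac)
  qed
  have normT: "ell2_norm N (?T u) = sqrt c * L2_set (\<lambda>j. cmod (u j)) X" for u
  proof -
    have "(\<Sum>j<N. (cmod (?T u j))\<^sup>2) = (\<Sum>j\<in>X. (cmod (\<Sum>l\<in>X. K j l * u l))\<^sup>2)"
      using XN X(1) by (intro sum.mono_neutral_cong_right) (auto simp: T simp del: o_apply)
    also have "\<dots> = c * (\<Sum>l\<in>X. (cmod (u l))\<^sup>2)"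
      by (rule sum_norm_sq_of_orthogonal_columns[OF orthK fin])
    finally show ?thesis
      by (simp add: ell2_norm_def L2_set_def real_sqrt_mult)
  qed
  have le: "ell2_norm N (?T u) / ell2_norm N u \<le> sqrt c" for u
  proof -
    have "L2_set (\<lambda>j. cmod (u j)) X \<le> ell2_norm N u"
      unfolding ell2_norm_def L2_set_def
      using X(1) by (intro real_sqrt_le_mono sum_mono2) auto
    then have "ell2_norm N (?T u) \<le> sqrt c * ell2_norm N u"
      unfolding normT using \<open>0 \<le> c\<close> by (intro mult_left_mono) auto
    moreover have "0 \<le> ell2_norm N u"
      by (simp add: ell2_norm_def L2_set_nonneg)
    ultimately show ?thesis
      using \<open>0 \<le> c\<close> by (cases "ell2_norm N u = 0") (simp_all add: divide_le_eq)
  qed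
  define v :: "nat \<Rightarrow> complex" where "v = (\<lambda>j\<in>{..<N}. indicator X j)"
  have "v \<in> ell2 N"
    by (simp add: v_def ell2_def)
  have sums: "(\<Sum>j<N. (cmod (v j))\<^sup>2) = real (card X)" "(\<Sum>j\<in>X. (cmod (v j))\<^sup>2) = real (card X)"
  proof -
    show *: "(\<Sum>j\<in>X. (cmod (v j))\<^sup>2) = real (card X)"
      using X(1) by (subst sum.cong[OF refl, of _ _ "\<lambda>_. 1"]) (auto simp: v_def)
    show "(\<Sum>j<N. (cmod (v j))\<^sup>2) = real (card X)"
      unfolding *[symmetric] using X(1)
      by (intro sum.mono_neutral_right) (auto simp: v_def)
  qed
  have "card X > 0" using X(2) fin by (simp add: card_gt_0_iff)
  then have eq: "ell2_norm N (?T v) / ell2_norm N v = sqrt c"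
    unfolding normT by (simp add: ell2_norm_def L2_set_def sums)
  show ?thesis
    unfolding ell2_opnorm_def
    by (rule cSup_eq_maximum) (use eq \<open>v \<in> ell2 N\<close> le in \<open>force+\<close>)
qed

section \<open>The uncertainty exponent\<close>

lemma cantor_norm_eq:
  assumes A: "A \<subseteq> {0..<M}" "A \<noteq> {}"
    and zero: "\<forall>b\<in>A. \<forall>b'\<in>A. b \<noteq> b' \<longrightarrow> G_fun M A ((real b - real b') / real M) = 0"
  shows "cantor_norm M A k = (real (card A) / real M) powr (real k / 2)"
proof -
  have "M > 0" using A by auto
  have "card A > 0"
    using A finite_subset[of A "{0..<M}"] by (simp add: card_gt_0_iff)
  let ?q = "real (card A) / real M"
  have q: "?q > 0" using \<open>M > 0\<close> \<open>card A > 0\<close> by simp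
  have "real (M ^ k) * ?q ^ k = real (card A ^ k)"
    using \<open>M > 0\<close> by (simp add: power_divide)
  then have "cantor_norm M A k = sqrt (?q ^ k)"
    unfolding cantor_norm_def
    using cantor_exp_sum_orthogonal[OF A(1) \<open>M > 0\<close> zero]
      cantor_set_bounded[OF A(1)] cantor_set_nonempty[OF A(2)] q
    by (intro ell2_opnorm_of_orthogonal_block) simp_all
  also have "\<dots> = ?q powr (real k / 2)"
    using q by (simp add: powr_half_sqrt[symmetric] powr_powr powr_realpow[symmetric])
  finally show ?thesis .
qed

theorem proposition3p13:
  fixes M :: nat and A :: "nat set" and \<delta> :: real
  assumes "A \<subseteq> {0..<M}"
    and "1 < card A" and "card A < M"
    and "\<delta> = ln (real (card A)) / ln (real M)"
    and "\<forall>b\<in>A. \<forall>b'\<in>A. b \<noteq> b' \<longrightarrow> G_fun M A ((real b - real b') / real M) = 0"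
  shows "(\<forall>k. cantor_norm M A k = (real (card A) / real M) powr (real k / 2)) \<and>
         convergent (fup_quotient M A) \<and>
         fup_exponent M A = (1 - \<delta>) / 2"
proof -
  have "A \<noteq> {}" using assms(2) by auto
  then have norm: "cantor_norm M A k = (real (card A) / real M) powr (real k / 2)" for k
    using cantor_norm_eq assms(1,5) by blast
  have "ln (real M) > 0" using assms(2,3) by simp
  have quot: "fup_quotient M A k = (\<delta> - 1) / 2" if "k > 0" for k
    using that assms(2,3) \<open>ln (real M) > 0\<close>
    by (simp add: fup_quotient_def norm assms(4) ln_powr ln_div field_simps)
  \<comment> \<open>The quotient at \<open>k = 0\<close> is \<open>0 / 0 = 0\<close>, so it is constant only eventually.\<close>
  have "eventually (\<lambda>k. fup_quotient M A k = (\<delta> - 1) / 2) sequentially"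
    by (rule eventually_mono[OF eventually_gt_at_top[of 0]]) (rule quot)
  then have lim: "fup_quotient M A \<longlonglongrightarrow> (\<delta> - 1) / 2"
    by (rule tendsto_eventually)
  then have "convergent (fup_quotient M A)"
    by (rule convergentI)
  moreover have "fup_exponent M A = (1 - \<delta>) / 2"
    unfolding fup_exponent_def limI[OF lim] by (simp add: field_simps)
  ultimately show ?thesis
    using norm by blast
qed

end
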